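(* Let $m\ge1$, let $k_1,\ldots,k_m\ge 2$ be integers with $k_1+\cdots+k_m=n$, and let $G=D_n(k_1,\ldots,k_m)$ with vertex set $X\cup Y\cup Z$ as in its definition. Then $G$ is vertex decomposable and $\mathrm{Shed}(G)=Z$.
   Context: $D_n(k_1,\ldots,k_m)$ is the graph on the $5n$ vertices $X\cup Y\cup Z$ with $X=\{x_1,\ldots,x_{2n}\}$, $Y=\{y_1,\ldots,y_{2n}\}$, $Z=\{z_1,\ldots,z_n\}$, whose edges are exactly: (i) all pairs in $Z$ (so $Z$ induces $K_n$); (ii) no edges within $Y$; (iii) the induced graph on $X$ is a disjoint union $K_{k_1,k_1}\sqcup\cdots\sqcup K_{k_m,k_m}$ where, with $w=\sum_{\ell=1}^{i-1}k_\ell$ ($w=0$ for $i=1$), the $i$-th complete bipartite graph has bipartition $\{x_{2w+1},x_{2w+3},\ldots,x_{2(w+k_i)-1}\}\cup\{x_{2w+2},x_{2w+4},\ldots,x_{2(w+k_i)}\}$; (iv) $\{x_j,y_j\}$ for $1\le j\le 2n$; (v) $\{z_j,y_{2j}\}$ and $\{z_j,y_{2j-1}\}$ for $1\le j\le n$. For a graph $G=(V,E)$ and $x\in V$, $G\setminus x$ is the graph obtained by deleting $x$ and its incident edges; $N[x]$ is $x$ together with its neighbours, and $G\setminus N[x]$ is obtained by deleting all vertices of $N[x]$ and their incident edges. A graph is well-covered if all its maximal independent sets have the same cardinality. A graph $G$ is vertex decomposable if $G$ is well-covered and either (i) $G$ has no edges (possibly no vertices), or (ii) there is a vertex $x$ such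 that both $G\setminus x$ and $G\setminus N[x]$ are vertex decomposable. For a vertex decomposable graph $G$, $\mathrm{Shed}(G)$ is the set of vertices $x$ such that $G\setminus x$ and $G\setminus N[x]$ are both vertex decomposable. *)

theory Defs
  imports Main
begin

text \<open>A graph is a pair of a vertex set and a set of edges, each edge being a two-element
  set of vertices.\<close>

type_synonym 'a graph = "'a set \<times> 'a set set"

abbreviation verts :: "'a graph \<Rightarrow> 'a set" where
  "verts G \<equiv> fst G"

abbreviation edges :: "'a graph \<Rightarrow> 'a set set" where
  "edges G \<equiv> snd G"

definition finite_simple_graph :: "'a graph \<Rightarrow> bool" where
  "finite_simple_graph G \<longleftrightarrow>
     finite (verts G) \<and> (\<forall>e\<in>edges G. e \<subseteq> verts G \<and> card e = 2)"

definition delete_verts :: "'a graph \<Rightarrow> 'a set \<Rightarrow> 'a graph" where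
  "delete_verts G S = (verts G - S, {e \<in> edges G. e \<inter> S = {}})"

definition closed_nbhd :: "'a graph \<Rightarrow> 'a \<Rightarrow> 'a set" where
  "closed_nbhd G x = insert x {y \<in> verts G. {x, y} \<in> edges G}"

definition independent_set :: "'a graph \<Rightarrow> 'a set \<Rightarrow> bool" where
  "independent_set G S \<longleftrightarrow> S \<subseteq> verts G \<and> (\<forall>u\<in>S. \<forall>v\<in>S. {u, v} \<notin> edges G)"

definition maximal_independent_set :: "'a graph \<Rightarrow> 'a set \<Rightarrow> bool" where
  "maximal_independent_set G S \<longleftrightarrow>
     independent_set G S \<and> (\<forall>T. independent_set G T \<and> S \<subseteq> T \<longrightarrow> T = S)"

definition well_covered :: "'a graph \<Rightarrow> bool" where
  "well_covered G \<longleftrightarrow>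
     (\<forall>S T. maximal_independent_set G S \<and> maximal_independent_set G T \<longrightarrow> card S = card T)"

inductive vertex_decomposable :: "'a graph \<Rightarrow> bool" where
  no_edges: "well_covered G \<Longrightarrow> edges G = {} \<Longrightarrow> vertex_decomposable G"
| shedding: "well_covered G \<Longrightarrow> x \<in> verts G \<Longrightarrow>
     vertex_decomposable (delete_verts G {x}) \<Longrightarrow>
     vertex_decomposable (delete_verts G (closed_nbhd G x)) \<Longrightarrow>
     vertex_decomposable G"

definition Shed :: "'a graph \<Rightarrow> 'a set" where
  "Shed G = {x \<in> verts G. vertex_decomposable (delete_verts G {x}) \<and>
                          vertex_decomposable (delete_verts G (closed_nbhd G x))}"

datatype vertex = vx nat | vy nat | vz nat

definition X_verts :: "nat \<Rightarrow> vertex set" where "X_verts n = vx ` {1..2 * n}"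
definition Y_verts :: "nat \<Rightarrow> vertex set" where "Y_verts n = vy ` {1..2 * n}"
definition Z_verts :: "nat \<Rightarrow> vertex set" where "Z_verts n = vz ` {1..n}"

text \<open>\<open>D_graph n m k\<close> is the graph \<open>D\<^sub>n(k\<^sub>1, \<dots>, k\<^sub>m)\<close>, with \<open>k\<^sub>i\<close> given as \<open>k i\<close> for
  \<open>1 \<le> i \<le> m\<close>; values of \<open>k\<close> at other arguments are not used.\<close>

definition D_graph :: "nat \<Rightarrow> nat \<Rightarrow> (nat \<Rightarrow> nat) \<Rightarrow> vertex graph" where
  "D_graph n m k = (X_verts n \<union> Y_verts n \<union> Z_verts n,
     {{vz i, vz j} | i j. i \<in> {1..n} \<and> j \<in> {1..n} \<and> i \<noteq> j} \<union>
     (\<Union>i\<in>{1..m}. let w = (\<Sum>l=1..<i. k l) in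
        {{vx (2 * (w + a) - 1), vx (2 * (w + b))} | a b. a \<in> {1..k i} \<and> b \<in> {1..k i}}) \<union>
     {{vx j, vy j} | j. j \<in> {1..2 * n}} \<union>
     {{vz j, vy (2 * j)} | j. j \<in> {1..n}} \<union>
     {{vz j, vy (2 * j - 1)} | j. j \<in> {1..n}})"

lemma finite_simple_graph_D_graph:
  assumes "(\<Sum>i=1..m. k i) = n"
  shows "finite_simple_graph (D_graph n m k)"
proof -
  have block: "(\<Sum>l=1..<i. k l) + k i \<le> n" if "i \<in> {1..m}" for i
  proof -
    have "(\<Sum>l=1..<i. k l) + k i = (\<Sum>l=1..i. k l)"
      using that by (simp add: atLeastLessThanSuc_atLeastAtMost [symmetric])
    also have "\<dots> \<le> (\<Sum>l=1..m. k l)"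
      using that by (intro sum_mono2) auto
    finally show ?thesis using assms by simp
  qed
  have inX: "vx (2 * (w + a) - 1) \<in> X_verts n \<and> vx (2 * (w + b)) \<in> X_verts n \<and>
      vx (2 * (w + a) - 1) \<noteq> vx (2 * (w + b))"
    if "w + k i \<le> n" "a \<in> {1..k i}" "b \<in> {1..k i}" for w a b i
    using that unfolding X_verts_def by (auto intro!: imageI) presburger
  show ?thesis
    unfolding finite_simple_graph_def
  proof (intro conjI ballI)
    show "finite (verts (D_graph n m k))"
      by (simp add: D_graph_def X_verts_def Y_verts_def Z_verts_def)
  next
    fix e assume "e \<in> edges (D_graph n m k)"
    then consider (zz) i j where "e = {vz i, vz j}" "i \<in> {1..n}" "j \<in> {1..n}" "i \<noteq> j"
      | (xx) i w a b where "i \<in> {1..m}" "w = (\<Sum>l=1..<i. k l)" "a \<in> {1..k i}" "b \<in> {1..k i}"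
          "e = {vx (2 * (w + a) - 1), vx (2 * (w + b))}"
      | (xy) j where "e = {vx j, vy j}" "j \<in> {1..2 * n}"
      | (zy) j where "e = {vz j, vy (2 * j)}" "j \<in> {1..n}"
      | (zy') j where "e = {vz j, vy (2 * j - 1)}" "j \<in> {1..n}"
      unfolding D_graph_def Let_def snd_conv by blast
    then have "e \<subseteq> X_verts n \<union> Y_verts n \<union> Z_verts n \<and> card e = 2"
    proof cases
      case xx
      then show ?thesis using inX[of w i a b] block[of i] by auto
    next
      case zy'
      then have "2 * j - 1 \<in> {1..2 * n}" by auto
      then show ?thesis using zy' by (auto simp: Y_verts_def Z_verts_def)
    qed (auto simp: X_verts_def Y_verts_def Z_verts_def)
    then show "e \<subseteq> verts (D_graph n m k)" "card e = 2"
      by (simp_all add: D_graph_def)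
  qed
qed

end

theory Submission
  imports Defs
begin

text \<open>
  Deleting all of \<open>Z\<close> leaves the whiskered graph on \<open>X\<close>, and deleting \<open>N[z\<^sub>i]\<close> leaves \<open>X\<close> with all
  whiskers except those at \<open>x\<^sub>2\<^sub>i\<^sub>-\<^sub>1\<close> and \<open>x\<^sub>2\<^sub>i\<close>.  As the components of \<open>X\<close> are complete bipartite,
  the edge \<open>{x\<^sub>2\<^sub>i\<^sub>-\<^sub>1, x\<^sub>2\<^sub>i}\<close> is a strong clique of \<open>X\<close>: no independent set dominates it.
  A graph whose unwhiskered vertices form a strong clique is vertex decomposable, shedding whiskered
  vertices first: if \<open>Q\<close> is strong, then \<open>Q - N(x)\<close> is strong after deleting \<open>N[x]\<close>.
  So the vertices of \<open>Z\<close> can be shed one after another.  Deleting some \<open>x\<^sub>j\<close> or \<open>y\<^sub>j\<close> instead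
  destroys well-coveredness: since \<open>k\<^sub>i \<ge> 2\<close>, the remaining partner can be dominated from elsewhere
  in its block, which gives a maximal independent set of size \<open>2n - 1\<close> besides one of size \<open>2n\<close>.
\<close>

section \<open>Induced subgraphs\<close>

text \<open>All graphs of the recursion share one edge set \<open>E\<close>, so that a deletion
  becomes a set difference of vertices.\<close>

definition induced :: "'a set set \<Rightarrow> 'a set \<Rightarrow> 'a graph" where
  "induced E U = (U, {e \<in> E. e \<subseteq> U})"

lemma verts_induced [simp]: "verts (induced E U) = U"
  by (simp add: induced_def)

lemma delete_verts_induced [simp]: "delete_verts (induced E U) S = induced E (U - S)"
  by (auto simp: delete_verts_def induced_def)

lemma closed_nbhd_induced:
  "x \<in> U \<Longrightarrow> closed_nbhd (induced E U) x = insert x {y \<in> U. {x, y} \<in> E}"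
  by (auto simp: closed_nbhd_def induced_def)

lemma finite_simple_graph_induced:
  assumes "finite_simple_graph G"
  shows "induced (edges G) (verts G) = G"
  using assms by (auto simp: finite_simple_graph_def induced_def intro!: prod_eqI)

text \<open>A vertex that \<open>S\<close> does not dominate could be added to it. Looplessness
  matters because \<open>independent_set\<close> also tests \<open>u = v\<close>, that is, the
  singleton \<open>{v}\<close>.\<close>

lemma maximal_independent_set_induced:
  assumes "\<And>v. {v} \<notin> E"
  shows "maximal_independent_set (induced E U) S \<longleftrightarrow>
    S \<subseteq> U \<and> (\<forall>u\<in>S. \<forall>v\<in>S. {u, v} \<notin> E) \<and> (\<forall>v\<in>U - S. \<exists>u\<in>S. {u, v} \<in> E)"
    (is "_ \<longleftrightarrow> ?R")
proof
  assume M: "maximal_independent_set (induced E U) S"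
  then have S: "S \<subseteq> U" "\<forall>u\<in>S. \<forall>v\<in>S. {u, v} \<notin> E"
    by (auto simp: maximal_independent_set_def independent_set_def induced_def)
  have "\<exists>u\<in>S. {u, v} \<in> E" if v: "v \<in> U - S" for v
  proof (rule ccontr)
    assume neg: "\<not> ?thesis"
    have "independent_set (induced E U) (insert v S)"
      using S v neg assms
      by (auto simp: independent_set_def induced_def insert_commute)
    then show False
      using M v by (auto simp: maximal_independent_set_def)
  qed
  then show ?R using S by blast
next
  assume R: ?R
  have "T = S" if T: "independent_set (induced E U) T" "S \<subseteq> T" for T
  proof (rule ccontr)
    assume "T \<noteq> S"
    then obtain v where v: "v \<in> T" "v \<notin> S" using T by blast
    then have "v \<in> U - S" using T by (auto simp: independent_set_def)
    then obtain u where u: "u \<in> S" "{u, v} \<in> E" using R by blast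
    then have "{u, v} \<in> edges (induced E U)"
      using R \<open>v \<in> U - S\<close> by (auto simp: induced_def)
    then show False
      using T u v unfolding independent_set_def by blast
  qed
  then show "maximal_independent_set (induced E U) S"
    using R by (auto simp: maximal_independent_set_def independent_set_def induced_def)
qed

lemma well_coveredI:
  assumes "\<And>S. maximal_independent_set G S \<Longrightarrow> card S = d"
  shows "well_covered G"
  using assms by (auto simp: well_covered_def)

lemma vertex_decomposable_well_covered: "vertex_decomposable G \<Longrightarrow> well_covered G"
  by (auto elim: vertex_decomposable.cases)

text \<open>Domination survives because the vertices dominated by \<open>x\<close> leave the graph
  together with \<open>x\<close>.\<close>

lemma maximal_independent_set_link:
  assumes "\<And>v. {v} \<notin> E" "maximal_independent_set (induced E U) S" "x \<in> S"
  shows "maximal_independent_set (induced E (U - closed_nbhd (induced E U) x)) (S - {x})"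
proof -
  have "x \<in> U" using assms by (auto simp: maximal_independent_set_induced)
  then show ?thesis
    using assms
    by (fastforce simp: maximal_independent_set_induced closed_nbhd_induced)
qed

lemma maximal_independent_set_deletion:
  assumes "\<And>v. {v} \<notin> E" "maximal_independent_set (induced E U) S" "S \<inter> B = {}"
  shows "maximal_independent_set (induced E (U - B)) S"
  using assms by (auto simp: maximal_independent_set_induced)


section \<open>Partially whiskered graphs\<close>

text \<open>Ranging over all independent sets, not only maximal ones, lets the property pass to
  smaller \<open>W\<close>. Empty \<open>S\<close> forces \<open>Q\<close> to be nonempty, so fully
  whiskered graphs are covered below by the separate alternative
  \<open>W \<subseteq> T\<close>.\<close>

definition strong_clique :: "'a set set \<Rightarrow> 'a set \<Rightarrow> 'a set \<Rightarrow> bool" where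
  "strong_clique E W Q \<longleftrightarrow> Q \<subseteq> W \<and> (\<forall>p\<in>Q. \<forall>q\<in>Q. p \<noteq> q \<longrightarrow> {p, q} \<in> E) \<and>
    (\<forall>S\<subseteq>W. (\<forall>u\<in>S. \<forall>v\<in>S. {u, v} \<notin> E) \<longrightarrow> (\<exists>p\<in>Q. \<forall>s\<in>S. {p, s} \<notin> E))"

text \<open>Here \<open>f t\<close> is the leaf attached to \<open>t\<close>.  The set \<open>T\<close> is not required to lie inside \<open>W\<close>:
  for \<open>t\<close> outside \<open>W\<close> the leaf \<open>f t\<close> is an isolated vertex.\<close>

definition whiskering :: "'a set set \<Rightarrow> ('a \<Rightarrow> 'a) \<Rightarrow> 'a set \<Rightarrow> 'a set \<Rightarrow> bool" where
  "whiskering E f W T \<longleftrightarrow> inj_on f T \<and> f ` T \<inter> W = {} \<and>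
    (\<forall>t\<in>T. \<forall>v\<in>W. {f t, v} \<in> E \<longleftrightarrow> v = t) \<and> (\<forall>t\<in>T. \<forall>s\<in>T. {f t, f s} \<notin> E)"

lemma whiskering_mono: "whiskering E f W T \<Longrightarrow> W' \<subseteq> W \<Longrightarrow> T' \<subseteq> T \<Longrightarrow> whiskering E f W' T'"
  unfolding whiskering_def by (blast intro: inj_on_subset)

lemma strong_clique_mono: "strong_clique E W Q \<Longrightarrow> Q \<subseteq> W' \<Longrightarrow> W' \<subseteq> W \<Longrightarrow> strong_clique E W' Q"
  unfolding strong_clique_def by (meson subset_trans)

text \<open>An independent set of the smaller graph stays independent when \<open>x\<close> is
  added. The vertex of \<open>Q\<close> that the larger set fails to dominate is not adjacent to
  \<open>x\<close>, so it survives.\<close>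

lemma strong_clique_link:
  assumes "\<And>v. {v} \<notin> E" "strong_clique E W Q" "x \<in> W" "x \<notin> Q"
  shows "strong_clique E (W - insert x {y \<in> W. {x, y} \<in> E}) (Q - insert x {y \<in> W. {x, y} \<in> E})"
proof -
  let ?N = "insert x {y \<in> W. {x, y} \<in> E}"
  have "\<exists>p\<in>Q - ?N. \<forall>s\<in>S. {p, s} \<notin> E"
    if S: "S \<subseteq> W - ?N" "\<forall>u\<in>S. \<forall>v\<in>S. {u, v} \<notin> E" for S
  proof -
    have "insert x S \<subseteq> W" "\<forall>u\<in>insert x S. \<forall>v\<in>insert x S. {u, v} \<notin> E"
      using S assms by (auto simp: insert_commute)
    then obtain p where "p \<in> Q" "\<forall>s\<in>insert x S. {p, s} \<notin> E"
      using assms(2) unfolding strong_clique_def by meson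
    then have "p \<in> Q - ?N" "\<forall>s\<in>S. {p, s} \<notin> E" using assms(4) by (auto simp: insert_commute)
    then show ?thesis by blast
  qed
  then show ?thesis using assms(2) unfolding strong_clique_def by blast
qed

text \<open>The pairs \<open>{t, f t}\<close>, cut down to the vertex set, and the clique
  \<open>W - T\<close>, if nonempty, partition the vertices into cliques. \<open>S\<close> meets
  each of them exactly once.\<close>

lemma card_maximal_independent_set_whiskered:
  assumes "\<And>v. {v} \<notin> E" and fin: "finite W" "finite T" and wh: "whiskering E f W T"
    and sc: "W \<subseteq> T \<or> strong_clique E W (W - T)"
    and M: "maximal_independent_set (induced E (W \<union> f ` T)) S"
  shows "card S = card T + (if W \<subseteq> T then 0 else 1)"
proof -
  \<comment> \<open>\<open>c\<close> names the clique containing \<open>v\<close>: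
    \<open>Some t\<close> for that of the leaf \<open>f t\<close>, and \<open>None\<close> for
    \<open>W - T\<close>.\<close>
  define c where "c v = (if v \<in> W then if v \<in> T then Some v else None else Some (the_inv_into T f v))"
    for v
  have S: "S \<subseteq> W \<union> f ` T" "\<And>u v. u \<in> S \<Longrightarrow> v \<in> S \<Longrightarrow> {u, v} \<notin> E"
    "\<And>v. v \<in> W \<union> f ` T \<Longrightarrow> v \<notin> S \<Longrightarrow> \<exists>u\<in>S. {u, v} \<in> E"
    using M unfolding maximal_independent_set_induced[OF assms(1)] by blast+
  have inj: "inj_on f T" and disj: "\<And>t. t \<in> T \<Longrightarrow> f t \<notin> W"
    and leaf: "\<And>t v. t \<in> T \<Longrightarrow> v \<in> W \<Longrightarrow> {f t, v} \<in> E \<longleftrightarrow> v = t"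
    and leaves: "\<And>t s. t \<in> T \<Longrightarrow> s \<in> T \<Longrightarrow> {f t, f s} \<notin> E"
    using wh by (auto simp: whiskering_def)
  have c_W: "c v = Some v" if "v \<in> W" "v \<in> T" for v using that by (simp add: c_def)
  have c_Q: "c v = None" if "v \<in> W" "v \<notin> T" for v using that by (simp add: c_def)
  have c_leaf: "c (f t) = Some t" if "t \<in> T" for t
    using that disj[OF that] the_inv_into_f_f[OF inj that] by (simp add: c_def)
  have clique: "{u, v} \<in> E" if "u \<in> W - T" "v \<in> W - T" "u \<noteq> v" for u v
  proof -
    have "strong_clique E W (W - T)" using sc that by blast
    then show ?thesis using that by (simp add: strong_clique_def)
  qed
  have "inj_on c S"
  proof (rule inj_onI)
    fix u v assume uv: "u \<in> S" "v \<in> S" "c u = c v"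
    have "u \<in> W \<or> (\<exists>t\<in>T. u = f t)" "v \<in> W \<or> (\<exists>t\<in>T. v = f t)"
      using uv(1,2) S(1) by auto
    then consider "u \<in> W" "v \<in> W" | t where "t \<in> T" "u = f t" "v \<in> W" | t where "t \<in> T" "v = f t" "u \<in> W"
      | t s where "t \<in> T" "u = f t" "s \<in> T" "v = f s"
      by blast
    then show "u = v"
    proof cases
      case 1
      then have "u = v \<or> u \<notin> T \<and> v \<notin> T" using uv(3) by (simp add: c_def split: if_splits)
      then show ?thesis using 1 uv S(2)[of u v] clique[of u v] by blast
    next
      case 2
      then have "c v = Some t" using uv(3) c_leaf by simp
      then have "v = t" using 2(3) c_W[of v] c_Q[of v] by (cases "v \<in> T") auto
      then show ?thesis using 2 leaf uv S(2) by blast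
    next
      case 3
      then have "c u = Some t" using uv(3) c_leaf by simp
      then have "u = t" using 3(3) c_W[of u] c_Q[of u] by (cases "u \<in> T") auto
      then show ?thesis using 3 leaf uv S(2) by blast
    next
      case 4
      then show ?thesis using uv(3) c_leaf by simp
    qed
  qed
  \<comment> \<open>Every clique is met: a leaf \<open>f t\<close> outside \<open>S\<close> can be
    dominated only by \<open>t\<close>, and \<open>W - T\<close> is met by strength.\<close>
  moreover have "c ` S = Some ` T \<union> (if W \<subseteq> T then {} else {None})"
  proof (intro equalityI subsetI)
    fix y assume "y \<in> c ` S"
    then obtain v where v: "y = c v" "v \<in> W \<or> v \<in> f ` T" using S(1) by blast
    show "y \<in> Some ` T \<union> (if W \<subseteq> T then {} else {None})"
    proof (cases "v \<in> W")
      case True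
      then show ?thesis using v(1) c_W[of v] c_Q[of v] by (cases "v \<in> T") auto
    next
      case False
      then show ?thesis using v c_leaf by auto
    qed
  next
    fix y assume y: "y \<in> Some ` T \<union> (if W \<subseteq> T then {} else {None})"
    show "y \<in> c ` S"
    proof (cases y)
      case (Some t)
      then have t: "t \<in> T" using y by (auto split: if_splits)
      show ?thesis
      proof (cases "f t \<in> S")
        case True
        then show ?thesis using c_leaf[OF t] Some by (metis imageI)
      next
        case False
        then obtain u where "u \<in> S" "{u, f t} \<in> E" using S(3) t by blast
        then have "u \<in> W"
          using S(1) leaves t by blast
        then have "u = t"
          using leaf[OF t] \<open>{u, f t} \<in> E\<close> by (simp add: insert_commute)
        then have "y = c u" using c_W t Some \<open>u \<in> W\<close> by simp
        then show ?thesis using \<open>u \<in> S\<close> by blast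
      qed
    next
      case None
      then have "strong_clique E W (W - T)" using y sc by (auto split: if_splits)
      moreover have "S \<inter> W \<subseteq> W" "\<forall>u\<in>S \<inter> W. \<forall>v\<in>S \<inter> W. {u, v} \<notin> E" using S(2) by auto
      ultimately obtain p where p: "p \<in> W - T" "\<forall>s\<in>S \<inter> W. {p, s} \<notin> E"
        unfolding strong_clique_def by meson
      \<comment> \<open>No leaf hangs at \<open>p\<close>, and \<open>S \<inter> W\<close> does not
        dominate it, so maximality puts \<open>p\<close> into \<open>S\<close>.\<close>
      have "p \<in> S"
      proof (rule ccontr)
        assume "p \<notin> S"
        then obtain u where "u \<in> S" "{u, p} \<in> E" using S(3) p by blast
        moreover have "u \<notin> W" using calculation p by (auto simp: insert_commute)
        then obtain t where "t \<in> T" "u = f t" using \<open>u \<in> S\<close> S(1) by blast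
        ultimately show False using p leaf[of t p] by blast
      qed
      moreover have "y = c p" using c_Q p None by simp
      ultimately show ?thesis by blast
    qed
  qed
  ultimately have "card S = card (Some ` T \<union> (if W \<subseteq> T then {} else {None}))"
    by (metis card_image)
  also have "\<dots> = card T + (if W \<subseteq> T then 0 else 1)"
    using fin by (auto simp: card_image card_insert_if)
  finally show ?thesis .
qed

text \<open>Induction on \<open>card W\<close>: the deletion and the link of a suitable
  \<open>x\<close> have the same form again, where leaves that lost their neighbour stay on as
  isolated vertices.\<close>

lemma vertex_decomposable_whiskered:
  assumes loopless: "\<And>v. {v} \<notin> E" and "finite W" "finite T" "whiskering E f W T"
    and "W \<subseteq> T \<or> strong_clique E W (W - T)" and "\<And>e. e \<in> E \<Longrightarrow> card e = 2"
  shows "vertex_decomposable (induced E (W \<union> f ` T))"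
  using assms(2-5)
proof (induction "card W" arbitrary: W T rule: less_induct)
  case less
  let ?U = "W \<union> f ` T"
  have wc: "well_covered (induced E ?U)"
    using card_maximal_independent_set_whiskered[OF loopless less.prems] by (rule well_coveredI)
  have leaf: "\<And>t v. t \<in> T \<Longrightarrow> v \<in> W \<Longrightarrow> {f t, v} \<in> E \<longleftrightarrow> v = t"
    and disj: "\<And>t. t \<in> T \<Longrightarrow> f t \<notin> W"
    and leaves: "\<And>t s. t \<in> T \<Longrightarrow> s \<in> T \<Longrightarrow> {f t, f s} \<notin> E"
    and inj: "inj_on f T"
    using less.prems(3) by (auto simp: whiskering_def)
  show ?case
  proof (cases "W = {}")
    case True
    have "e \<notin> E" if "e \<subseteq> f ` T" for e
    proof
      assume "e \<in> E"
      then obtain u v where "e = {u, v}" using assms(6) by (meson card_2_iff)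
      then show False using that leaves \<open>e \<in> E\<close> by auto
    qed
    then have "edges (induced E ?U) = {}" using True by (auto simp: induced_def)
    then show ?thesis using wc by (rule no_edges[rotated])
  next
    case False
    \<comment> \<open>Whiskered vertices go first, so that deletion leaves the strong clique intact.
      Once none remains, \<open>W\<close> itself is the clique and any vertex will do.\<close>
    obtain x where x: "x \<in> W" and xT: "x \<in> T \<or> W \<inter> T = {}" using False by blast
    let ?N = "insert x {y \<in> W. {x, y} \<in> E}"
    have smaller: "card (W - {x}) < card W" "card (W - ?N) < card W"
      using x less.prems(1) by (intro psubset_card_mono; blast)+
    have del: "vertex_decomposable (induced E ((W - {x}) \<union> f ` T))"
    proof (rule less.hyps[OF smaller(1)])
      show "W - {x} \<subseteq> T \<or> strong_clique E (W - {x}) (W - {x} - T)"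
      proof (cases "x \<in> T")
        case True
        then have "W - {x} - T = W - T" by blast
        then show ?thesis using less.prems(4) True strong_clique_mono[of E W "W - T" "W - {x}"] by auto
      next
        case False
        then have WT: "W \<inter> T = {}" using xT by blast
        then have "strong_clique E W W"
          using less.prems(4) x by (metis Diff_triv disjoint_iff subsetD)
        then have cl: "\<And>u v. u \<in> W \<Longrightarrow> v \<in> W \<Longrightarrow> u \<noteq> v \<Longrightarrow> {u, v} \<in> E"
          unfolding strong_clique_def by blast
        have eq: "W - {x} - T = W - {x}" using WT by blast
        \<comment> \<open>Any member of a nonempty \<open>S\<close> serves as \<open>p\<close>, by
          independence; for empty \<open>S\<close> any remaining vertex does.\<close>
        have "\<exists>p\<in>W - {x}. \<forall>s\<in>S. {p, s} \<notin> E"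
          if "S \<subseteq> W - {x}" "\<forall>u\<in>S. \<forall>v\<in>S. {u, v} \<notin> E" "W - {x} \<noteq> {}" for S
          using that by (cases "S = {}") blast+
        then show ?thesis using cl unfolding eq strong_clique_def by (cases "W - {x} = {}") auto
      qed
    qed (use less.prems in \<open>auto intro: whiskering_mono\<close>)
    have del_eq: "?U - {x} = (W - {x}) \<union> f ` T" using x disj by auto
    have link: "vertex_decomposable (induced E ((W - ?N) \<union> f ` (T - {x})))"
    proof (rule less.hyps[OF smaller(2)])
      show "W - ?N \<subseteq> T - {x} \<or> strong_clique E (W - ?N) (W - ?N - (T - {x}))"
      proof (cases "x \<in> T")
        case True
        have eq: "W - ?N - (T - {x}) = (W - T) - ?N" by blast
        show ?thesis
          using less.prems(4) strong_clique_link[OF loopless _ x, of "W - T"] True unfolding eq by blast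
      next
        case False
        \<comment> \<open>Here \<open>W\<close> is a clique containing \<open>x\<close>, so the link
          retains only leaves.\<close>
        then have "strong_clique E W (W - T)" "W - T = W" using less.prems(4) x xT by blast+
        then have "\<forall>y\<in>W. x \<noteq> y \<longrightarrow> {x, y} \<in> E" using x by (simp add: strong_clique_def)
        then have "W - ?N = {}" by auto
        then show ?thesis by blast
      qed
    qed (use less.prems in \<open>auto intro: whiskering_mono\<close>)
    \<comment> \<open>Among the leaves only \<open>f x\<close> lies in the closed neighbourhood of
      \<open>x\<close>.\<close>
    have link_eq: "?U - closed_nbhd (induced E ?U) x = (W - ?N) \<union> f ` (T - {x})"
      using x disj leaf leaves inj by (auto simp: closed_nbhd_induced insert_commute inj_on_def)
    show ?thesis
    proof (rule shedding[OF wc])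
      show "x \<in> verts (induced E ?U)" using x by simp
      show "vertex_decomposable (delete_verts (induced E ?U) {x})"
        using del by (simp only: delete_verts_induced del_eq)
      show "vertex_decomposable (delete_verts (induced E ?U) (closed_nbhd (induced E ?U) x))"
        using link by (simp only: delete_verts_induced link_eq)
    qed
  qed
qed


section \<open>The graph \<open>D\<^sub>n(k\<^sub>1, \<dots>, k\<^sub>m)\<close>\<close>

locale D_parameters =
  fixes n m :: nat and k :: "nat \<Rightarrow> nat"
  assumes k_ge_2: "\<forall>i\<in>{1..m}. k i \<ge> 2" and sum_k: "(\<Sum>i=1..m. k i) = n"
begin

abbreviation E where "E \<equiv> edges (D_graph n m k)"

section \<open>Blocks of \<open>X\<close> and the adjacency relation\<close>

definition offset :: "nat \<Rightarrow> nat" where "offset t = (\<Sum>l=1..<t. k l)"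

text \<open>These are the indices of the \<open>t\<close>-th bipartite component;
  \<open>offset t\<close> is the \<open>w\<close> of \<open>D_graph\<close>.\<close>

definition block :: "nat \<Rightarrow> nat set" where "block t = {2 * offset t<..2 * offset (Suc t)}"

lemma offset_Suc: "1 \<le> t \<Longrightarrow> offset (Suc t) = offset t + k t"
  by (simp add: offset_def)

lemma offset_mono: "s \<le> t \<Longrightarrow> offset s \<le> offset t"
  unfolding offset_def by (rule sum_mono2) auto

lemma offset_end: "offset (Suc m) = n"
  using sum_k by (simp add: offset_def atLeastLessThanSuc_atLeastAtMost del: sum.op_ivl_Suc)

lemma block_unique:
  assumes "i \<in> block s" "i \<in> block t"
  shows "s = t"
proof (rule ccontr)
  assume "s \<noteq> t"
  then have "Suc s \<le> t \<or> Suc t \<le> s" by linarith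
  then show False
    using assms offset_mono[of "Suc s" t] offset_mono[of "Suc t" s] by (auto simp: block_def)
qed

lemma block_exists:
  assumes "i \<in> {1..2 * n}"
  obtains t where "t \<in> {1..m}" "i \<in> block t"
proof -
  define t where "t = (LEAST t. i \<le> 2 * offset (Suc t))"
  have m: "i \<le> 2 * offset (Suc m)" using assms offset_end by simp
  have 1: "i \<le> 2 * offset (Suc t)" unfolding t_def using m by (rule LeastI)
  have 2: "t \<le> m" unfolding t_def using m by (rule Least_le)
  \<comment> \<open>\<open>offset 1 = 0\<close> but \<open>i \<ge> 1\<close>, so the least index is
    positive and minimality can be applied at \<open>t - 1\<close>.\<close>
  have 3: "t \<noteq> 0"
  proof
    assume "t = 0"
    then show False using 1 assms by (simp add: offset_def)
  qed
  have "\<not> i \<le> 2 * offset (Suc (t - 1))"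
    using 3 not_less_Least[of "t - 1" "\<lambda>t. i \<le> 2 * offset (Suc t)"] unfolding t_def by simp
  then show thesis using that[of t] 1 2 3 by (auto simp: block_def)
qed

text \<open>The two sides of a component are the odd and the even indices of its block, so adjacency
  becomes a symmetric parity condition.\<close>

lemma edge_xx:
  "{vx i, vx j} \<in> E \<longleftrightarrow> (\<exists>t\<in>{1..m}. i \<in> block t \<and> j \<in> block t \<and> odd (i + j))"
  (is "_ \<longleftrightarrow> ?R")
proof -
  have "{vx i, vx j} \<in> E \<longleftrightarrow> (\<exists>t\<in>{1..m}. \<exists>a\<in>{1..k t}. \<exists>b\<in>{1..k t}.
      i = 2 * (offset t + a) - 1 \<and> j = 2 * (offset t + b) \<or>
      j = 2 * (offset t + a) - 1 \<and> i = 2 * (offset t + b))"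
    unfolding D_graph_def Let_def offset_def snd_conv
    by (simp add: Bex_def doubleton_eq_iff del: One_nat_def) blast
  also have "\<dots> \<longleftrightarrow> ?R"
  proof (rule bex_cong[OF refl])
    fix t assume t: "t \<in> {1..m}"
    then have bl: "block t = {2 * offset t<..2 * offset t + 2 * k t}"
      by (simp add: block_def offset_Suc)
    have *: "(\<exists>a\<in>{1..k t}. \<exists>b\<in>{1..k t}. i = 2 * (offset t + a) - 1 \<and> j = 2 * (offset t + b))
      \<longleftrightarrow> i \<in> block t \<and> j \<in> block t \<and> odd i \<and> even j" (is "?A \<longleftrightarrow> ?B") for i j
    proof
      assume ?B
      then obtain a b where ab: "i = 2 * a + 1" "j = 2 * b" by (auto elim!: oddE evenE)
      \<comment> \<open>The odd index \<open>2 * a + 1\<close> is \<open>2 * (a + 1) - 1\<close>,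
        hence the shift in the first witness.\<close>
      with \<open>?B\<close> have "a + 1 - offset t \<in> {1..k t}" "b - offset t \<in> {1..k t}"
        "i = 2 * (offset t + (a + 1 - offset t)) - 1" "j = 2 * (offset t + (b - offset t))"
        by (auto simp: bl)
      then show ?A by blast
    qed (auto simp: bl)
    show "(\<exists>a\<in>{1..k t}. \<exists>b\<in>{1..k t}. i = 2 * (offset t + a) - 1 \<and> j = 2 * (offset t + b) \<or>
      j = 2 * (offset t + a) - 1 \<and> i = 2 * (offset t + b))
      \<longleftrightarrow> i \<in> block t \<and> j \<in> block t \<and> odd (i + j)"
      using *[of i j] *[of j i] by auto
  qed
  finally show ?thesis .
qed

lemma edge_xy: "{vx i, vy j} \<in> E \<longleftrightarrow> i = j \<and> j \<in> {1..2 * n}"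
  and edge_yy: "{vy i, vy j} \<notin> E"
  and edge_xz: "{vx i, vz j} \<notin> E"
  and edge_yz: "{vy j, vz i} \<in> E \<longleftrightarrow> i \<in> {1..n} \<and> (j = 2 * i \<or> j = 2 * i - 1)"
  and edge_zz: "{vz i, vz j} \<in> E \<longleftrightarrow> i \<in> {1..n} \<and> j \<in> {1..n} \<and> i \<noteq> j"
  by (auto simp: D_graph_def Let_def doubleton_eq_iff)

lemma edge_yx: "{vy j, vx i} \<in> E \<longleftrightarrow> i = j \<and> j \<in> {1..2 * n}"
  and edge_zx: "{vz j, vx i} \<notin> E"
  and edge_zy: "{vz i, vy j} \<in> E \<longleftrightarrow> i \<in> {1..n} \<and> (j = 2 * i \<or> j = 2 * i - 1)"
  using edge_xy edge_xz edge_yz by (simp_all add: insert_commute)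

lemmas edge_simps = edge_xy edge_yy edge_xz edge_yz edge_zz edge_yx edge_zx edge_zy

lemma card_edge: "e \<in> E \<Longrightarrow> card e = 2"
  using finite_simple_graph_D_graph[OF sum_k] by (auto simp: finite_simple_graph_def)

lemma loopless: "{v} \<notin> E"
  using card_edge[of "{v}"] by auto

lemma block_subset: "t \<in> {1..m} \<Longrightarrow> block t \<subseteq> {1..2 * n}"
  using offset_mono[of "Suc t" "Suc m"] by (auto simp: block_def offset_end)

lemma edge_xx_range: "{vx i, vx j} \<in> E \<Longrightarrow> i \<in> {1..2 * n} \<and> j \<in> {1..2 * n} \<and> i \<noteq> j"
  unfolding edge_xx using block_subset by fastforce

text \<open>A walk of three edges ends on the opposite side of its component, and opposite sides are
  completely joined.\<close>

lemma edge_xx_path: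
  assumes "{vx a, vx p} \<in> E" "{vx p, vx q} \<in> E" "{vx q, vx b} \<in> E"
  shows "{vx a, vx b} \<in> E"
proof -
  obtain t where t: "t \<in> {1..m}" "a \<in> block t" "p \<in> block t" "odd (a + p)"
    using assms(1) unfolding edge_xx by blast
  then have "q \<in> block t" "odd (p + q)" using assms(2) block_unique by (auto simp: edge_xx)
  then have "b \<in> block t" "odd (q + b)" using assms(3) block_unique by (auto simp: edge_xx)
  then show ?thesis using t \<open>odd (p + q)\<close> by (auto simp: edge_xx)
qed

text \<open>Blocks begin just after an even number, so they never separate \<open>2 * i - 1\<close>
  from \<open>2 * i\<close>.\<close>

lemma edge_xx_pair:
  assumes "i \<in> {1..n}"
  shows "{vx (2 * i - 1), vx (2 * i)} \<in> E"
proof -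
  obtain t where "t \<in> {1..m}" "2 * i \<in> block t" using assms by (auto intro: block_exists[of "2 * i"])
  moreover from this have "2 * i - 1 \<in> block t" using assms by (auto simp: block_def)
  moreover have "odd (2 * i - 1 + 2 * i)" using assms by auto
  ultimately show ?thesis by (auto simp: edge_xx)
qed

text \<open>By \<open>k_ge_2\<close> the side opposite to \<open>vx j\<close> has at least two
  vertices, so one of them avoids \<open>p\<close>.\<close>

lemma edge_xx_other:
  assumes "j \<in> {1..2 * n}"
  obtains l where "{vx j, vx l} \<in> E" "l \<noteq> p"
proof -
  obtain t where t: "t \<in> {1..m}" "j \<in> block t" using assms by (rule block_exists)
  \<comment> \<open>The two smallest indices of the opposite parity in the block.\<close>
  define a b where "a = 2 * offset t + (if odd j then 2 else 1)" and "b = a + 2"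
  have "k t \<ge> 2" using k_ge_2 t by blast
  then have "a \<in> block t" "b \<in> block t" using t by (auto simp: a_def b_def block_def offset_Suc)
  moreover have "odd (j + a)" "odd (j + b)" by (auto simp: a_def b_def)
  ultimately have "{vx j, vx a} \<in> E" "{vx j, vx b} \<in> E" using t by (auto simp: edge_xx)
  moreover have "a \<noteq> p \<or> b \<noteq> p" by (auto simp: b_def)
  ultimately show thesis using that by blast
qed

section \<open>Whiskers and strong cliques of \<open>X\<close>\<close>

fun leaf :: "vertex \<Rightarrow> vertex" where
  "leaf (vx j) = vy j"
| "leaf v = v"

abbreviation "X \<equiv> X_verts n"
abbreviation "Y \<equiv> Y_verts n"

lemma mem_XYZ [simp]:
  "vx j \<in> X \<longleftrightarrow> j \<in> {1..2 * n}" "vy j \<notin> X" "vz j \<notin> X"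
  "vy j \<in> Y \<longleftrightarrow> j \<in> {1..2 * n}" "vx j \<notin> Y" "vz j \<notin> Y"
  by (auto simp: X_verts_def Y_verts_def)

lemma mem_leaf_image: "S \<subseteq> X \<Longrightarrow> v \<in> leaf ` S \<longleftrightarrow> (\<exists>j. v = vy j \<and> vx j \<in> S)"
  by (force simp: X_verts_def)

lemma leaf_X: "leaf ` X = Y"
  by (simp add: X_verts_def Y_verts_def image_image)

lemma whiskering_X: "T \<subseteq> X \<Longrightarrow> whiskering E leaf X T"
  unfolding whiskering_def inj_on_def
proof (intro conjI ballI impI)
  assume T: "T \<subseteq> X"
  show "leaf ` T \<inter> X = {}" using T by (auto simp only: disjoint_iff mem_leaf_image mem_XYZ)
  fix t assume t: "t \<in> T"
  then obtain i where i: "t = vx i" "i \<in> {1..2 * n}" using T by (auto simp: X_verts_def)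
  show "{leaf t, v} \<in> E \<longleftrightarrow> v = t" if "v \<in> X" for v
    using i that by (auto simp: X_verts_def edge_simps)
  fix s assume "s \<in> T"
  then obtain j where j: "s = vx j" using T by (auto simp: X_verts_def)
  show "{leaf t, leaf s} \<notin> E" using i j by (simp add: edge_simps)
  show "t = s" if "leaf t = leaf s" using i j that by simp
qed

lemma finite_X: "finite X"
  by (simp add: X_verts_def)

lemma card_X: "card X = 2 * n"
  by (simp add: X_verts_def card_image inj_on_def)

text \<open>If \<open>S\<close> dominated both vertices, through \<open>vx a\<close> and
  \<open>vx b\<close>, the walk \<open>a, 2 * i - 1, 2 * i, b\<close> would force an edge inside
  \<open>S\<close>.\<close>

lemma strong_clique_pair:
  assumes "i \<in> {1..n}"
  shows "strong_clique E X {vx (2 * i - 1), vx (2 * i)}"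
proof -
  let ?p = "vx (2 * i - 1)" and ?q = "vx (2 * i)"
  have "(\<forall>s\<in>S. {?p, s} \<notin> E) \<or> (\<forall>s\<in>S. {?q, s} \<notin> E)"
    if S: "S \<subseteq> X" "\<forall>u\<in>S. \<forall>v\<in>S. {u, v} \<notin> E" for S
  proof (rule ccontr)
    assume "\<not> ?thesis"
    then obtain a b where "vx a \<in> S" "{?p, vx a} \<in> E" "vx b \<in> S" "{?q, vx b} \<in> E"
      using S(1) unfolding X_verts_def by blast
    then show False
      using edge_xx_path[of a "2 * i - 1" "2 * i" b] edge_xx_pair[OF assms] S(2)
      by (auto simp: insert_commute)
  qed
  moreover have "{?p, ?q} \<subseteq> X" using assms by auto
  ultimately show ?thesis
    using edge_xx_pair[OF assms] unfolding strong_clique_def by (auto simp: insert_commute)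
qed

section \<open>Shedding the vertices of \<open>Z\<close>\<close>

definition U :: "nat set \<Rightarrow> vertex set" where "U A = X \<union> Y \<union> vz ` A"

text \<open>The vertices of \<open>X\<close> whose leaves survive in the link of
  \<open>vz i\<close>.\<close>

abbreviation T :: "nat \<Rightarrow> vertex set" where "T i \<equiv> X - {vx (2 * i - 1), vx (2 * i)}"

text \<open>Since \<open>Z\<close> is a clique, the link of \<open>vz i\<close> loses all of
  \<open>Z\<close> and just the two leaves attached to \<open>vz i\<close>.\<close>

lemma link_z:
  assumes "A \<subseteq> {1..n}" "i \<in> A"
  shows "U A - closed_nbhd (induced E (U A)) (vz i) = X \<union> leaf ` T i"
proof (rule set_eqI)
  fix v
  have "i \<in> {1..n}" "vz i \<in> U A" using assms by (auto simp: U_def)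
  then show "v \<in> U A - closed_nbhd (induced E (U A)) (vz i) \<longleftrightarrow> v \<in> X \<union> leaf ` T i"
    using assms by (cases v) (auto simp: U_def closed_nbhd_induced edge_simps mem_leaf_image)
qed

lemma whiskered_z:
  assumes "i \<in> {1..n}"
  shows "X \<subseteq> T i \<or> strong_clique E X (X - T i)"
proof -
  have "X - T i = {vx (2 * i - 1), vx (2 * i)}" using assms by auto
  then show ?thesis using strong_clique_pair[OF assms] by simp
qed

lemma vertex_decomposable_link_z:
  assumes "i \<in> {1..n}"
  shows "vertex_decomposable (induced E (X \<union> leaf ` T i))"
  by (rule vertex_decomposable_whiskered[OF loopless finite_X finite_Diff[OF finite_X]
        whiskering_X[OF Diff_subset] whiskered_z[OF assms] card_edge])

text \<open>If \<open>S\<close> misses \<open>Z\<close>, it is maximal in the fully whiskered graph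
  on \<open>X\<close>. Otherwise it contains some \<open>vz i\<close>, and the link contributes
  \<open>2n - 2\<close> for the whiskers and 1 for the strong clique.\<close>

lemma card_maximal_independent_set_U:
  assumes "A \<subseteq> {1..n}" "maximal_independent_set (induced E (U A)) S"
  shows "card S = 2 * n"
proof (cases "S \<inter> vz ` A = {}")
  case True
  have "U A - vz ` A = X \<union> leaf ` X" by (auto simp: U_def leaf_X)
  then have "maximal_independent_set (induced E (X \<union> leaf ` X)) S"
    using maximal_independent_set_deletion[OF loopless assms(2) True] by simp
  then show ?thesis
    using card_maximal_independent_set_whiskered[OF loopless finite_X finite_X whiskering_X] card_X
    by simp
next
  case False
  then obtain i where i: "i \<in> A" "vz i \<in> S" by blast
  then have in_n: "i \<in> {1..n}" using assms by blast
  then have pair: "vx (2 * i - 1) \<in> X" "vx (2 * i) \<in> X" "2 * i - 1 \<noteq> 2 * i"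
    by auto
  have "card (T i) = 2 * n - 2"
    using pair finite_X card_X by (simp add: card_Diff_subset)
  moreover have "maximal_independent_set (induced E (X \<union> leaf ` T i)) (S - {vz i})"
    using maximal_independent_set_link[OF loopless assms(2) i(2)] link_z[OF assms(1) i(1)] by simp
  then have "card (S - {vz i}) = card (T i) + (if X \<subseteq> T i then 0 else 1)"
    by (rule card_maximal_independent_set_whiskered[OF loopless finite_X finite_Diff[OF finite_X]
          whiskering_X[OF Diff_subset] whiskered_z[OF in_n]])
  moreover have "\<not> X \<subseteq> T i" using pair by blast
  moreover have "finite S"
  proof (rule finite_subset)
    show "S \<subseteq> U A" using assms(2) by (simp add: maximal_independent_set_induced loopless)
    show "finite (U A)"
      using assms(1) by (auto simp: U_def X_verts_def Y_verts_def intro: finite_subset)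
  qed
  moreover from this have "card S = Suc (card (S - {vz i}))" using i(2) by (rule card.remove)
  \<comment> \<open>This makes the truncated subtraction \<open>2 * n - 2\<close> exact.\<close>
  moreover have "n \<ge> 1" using in_n by auto
  ultimately show ?thesis by simp
qed

text \<open>\<open>A\<close> records the vertices of \<open>Z\<close> still present, and the
  induction sheds them one at a time down to the fully whiskered graph.\<close>

lemma vertex_decomposable_U:
  assumes "A \<subseteq> {1..n}"
  shows "vertex_decomposable (induced E (U A))"
  using finite_subset[OF assms finite_atLeastAtMost] assms
proof (induction A rule: finite_induct)
  case empty
  show ?case
    using vertex_decomposable_whiskered[OF loopless finite_X finite_X whiskering_X] card_edge
    by (simp add: U_def leaf_X)
next
  case (insert i A)
  have "U (insert i A) - {vz i} = U A"
    using insert.hyps by (auto simp: U_def)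
  then have "vertex_decomposable (delete_verts (induced E (U (insert i A))) {vz i})"
    using insert by simp
  moreover have "vertex_decomposable (delete_verts (induced E (U (insert i A)))
      (closed_nbhd (induced E (U (insert i A))) (vz i)))"
    using link_z[of "insert i A" i] vertex_decomposable_link_z[of i] insert.prems by simp
  moreover have "well_covered (induced E (U (insert i A)))"
    using card_maximal_independent_set_U[OF insert.prems] by (rule well_coveredI)
  moreover have "vz i \<in> verts (induced E (U (insert i A)))" by (simp add: U_def)
  ultimately show ?case by - (rule shedding[where x = "vz i"])
qed

lemma D_graph_induced: "induced E (U {1..n}) = D_graph n m k"
proof -
  have "U {1..n} = verts (D_graph n m k)" by (simp add: D_graph_def U_def Z_verts_def)
  then show ?thesis using finite_simple_graph_induced finite_simple_graph_D_graph[OF sum_k] by metis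
qed

section \<open>Deleting a vertex of \<open>X\<close> or \<open>Y\<close> destroys
  well-coveredness\<close>

lemma partner:
  assumes "j \<in> {1..2 * n}"
  obtains i p where "i \<in> {1..n}" "{j, p} = {2 * i - 1, 2 * i}" "j \<noteq> p" "p \<in> {1..2 * n}"
    "{vx j, vx p} \<in> E"
proof (cases "even j")
  case True
  then obtain i where "j = 2 * i" by blast
  moreover from this assms have "i \<in> {1..n}" "2 * i \<noteq> 2 * i - 1" "2 * i - 1 \<in> {1..2 * n}" by auto
  ultimately show thesis
    using that[of i "2 * i - 1"] edge_xx_pair[of i] by (simp add: insert_commute)
next
  case False
  then obtain i where "j = 2 * i + 1" by (blast elim: oddE)
  moreover from this assms have "Suc i \<in> {1..n}" "2 * Suc i \<in> {1..2 * n}" by auto presburger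
  ultimately show thesis
    using that[of "Suc i" "2 * Suc i"] edge_xx_pair[of "Suc i"] by simp
qed

text \<open>\<open>?S\<close> has \<open>2n\<close> elements and \<open>?S'\<close> only
  \<open>2n - 1\<close>: with its leaf gone, \<open>vx j\<close> need not be replaced, because
  \<open>vx l\<close> dominates it.\<close>

lemma not_well_covered_delete_y:
  assumes j: "j \<in> {1..2 * n}"
  shows "\<not> well_covered (induced E (U {1..n} - {vy j}))"
proof
  assume wc: "well_covered (induced E (U {1..n} - {vy j}))"
  obtain i p where p: "i \<in> {1..n}" "{j, p} = {2 * i - 1, 2 * i}" "j \<noteq> p" "p \<in> {1..2 * n}"
    "{vx j, vx p} \<in> E"
    using j by (rule partner)
  obtain l where l: "{vx j, vx l} \<in> E" "l \<noteq> p" using j by (rule edge_xx_other)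
  have l': "l \<in> {1..2 * n}" "l \<noteq> j" using edge_xx_range[OF l(1)] by auto
  let ?S = "insert (vx j) (vy ` ({1..2 * n} - {j}))"
  let ?S' = "insert (vx l) (vy ` ({1..2 * n} - {j, l}))"
  \<comment> \<open>As \<open>l\<close> is not the partner \<open>p\<close> of \<open>j\<close>, the
    two indices do not share a vertex of \<open>Z\<close>, so each \<open>vz a\<close> keeps a leaf
    in both sets.\<close>
  have z: "\<exists>u. u \<in> {1..2 * n} \<and> u \<noteq> j \<and> u \<noteq> l \<and> {vy u, vz a} \<in> E" if a: "a \<in> {1..n}" for a
  proof -
    have "\<not> {2 * a - 1, 2 * a} \<subseteq> {j, l}"
    proof
      assume "{2 * a - 1, 2 * a} \<subseteq> {j, l}"
      then have "{2 * a - 1, 2 * a} = {j, l}" using a by auto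
      then show False using p(1-3) l(2) a by (auto simp: doubleton_eq_iff) presburger+
    qed
    then obtain u where "u = 2 * a - 1 \<or> u = 2 * a" "u \<notin> {j, l}" by blast
    moreover from this a have "u \<in> {1..2 * n}" "{vy u, vz a} \<in> E" by (auto simp: edge_yz)
    ultimately show ?thesis by blast
  qed
  have "maximal_independent_set (induced E (U {1..n} - {vy j})) ?S"
  proof -
    have "\<exists>u\<in>?S. {u, v} \<in> E" if v: "v \<in> U {1..n} - {vy j} - ?S" for v
    proof (cases v)
      case (vx t)
      then have "vy t \<in> ?S" "{vy t, v} \<in> E" using v by (auto simp: U_def edge_simps)
      then show ?thesis by blast
    next
      case (vz a)
      then show ?thesis using v z[of a] by (auto simp: U_def)
    qed (use v in \<open>auto simp: U_def\<close>)
    then show ?thesis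
      using j loopless by (subst maximal_independent_set_induced) (auto simp: U_def edge_simps)
  qed
  moreover have "maximal_independent_set (induced E (U {1..n} - {vy j})) ?S'"
  proof -
    have "\<exists>u\<in>?S'. {u, v} \<in> E" if v: "v \<in> U {1..n} - {vy j} - ?S'" for v
    proof (cases v)
      case (vx t)
      show ?thesis
      proof (cases "t = j")
        case True
        then show ?thesis using vx l by (auto simp: insert_commute)
      next
        case False
        then have "vy t \<in> ?S'" "{vy t, v} \<in> E" using v vx by (auto simp: U_def edge_simps)
        then show ?thesis by blast
      qed
    next
      case (vy t)
      then have "t = l" using v by (auto simp: U_def)
      then show ?thesis using vy l' by (auto simp: edge_simps)
    next
      case (vz a)
      then show ?thesis using v z[of a] by (auto simp: U_def)
    qed
    then show ?thesis
      using l' loopless by (subst maximal_independent_set_induced) (auto simp: U_def edge_simps)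
  qed
  ultimately have "card ?S = card ?S'" using wc unfolding well_covered_def by blast
  moreover have "card ?S = Suc (card ({1..2 * n} - {j}))"
    by (subst card_insert_disjoint) (auto simp: card_image inj_on_def)
  moreover have "card ?S' = Suc (card ({1..2 * n} - {j, l}))"
    by (subst card_insert_disjoint) (auto simp: card_image inj_on_def)
  moreover have "card ({1..2 * n} - {j, l}) < card ({1..2 * n} - {j})"
  proof -
    have "card ({1..2 * n} - {j} - {l}) < card ({1..2 * n} - {j})"
      using l' by (intro card_Diff1_less) simp_all
    moreover have "{1..2 * n} - {j} - {l} = {1..2 * n} - {j, l}" by blast
    ultimately show ?thesis by simp
  qed
  ultimately show False by linarith
qed

text \<open>\<open>Y\<close> has \<open>2n\<close> elements. In \<open>?S'\<close>, of size
  \<open>2n - 1\<close>, \<open>vz i\<close> dominates the rest of \<open>Z\<close> and the leaves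
  \<open>vy j\<close> and \<open>vy p\<close>, while \<open>vx l\<close> dominates
  \<open>vx p\<close> and \<open>vy l\<close>.\<close>

lemma not_well_covered_delete_x:
  assumes j: "j \<in> {1..2 * n}"
  shows "\<not> well_covered (induced E (U {1..n} - {vx j}))"
proof
  assume wc: "well_covered (induced E (U {1..n} - {vx j}))"
  obtain i p where p: "i \<in> {1..n}" "{j, p} = {2 * i - 1, 2 * i}" "j \<noteq> p" "p \<in> {1..2 * n}"
    "{vx j, vx p} \<in> E"
    using j by (rule partner)
  \<comment> \<open>\<open>vx j\<close> has been deleted, so \<open>vx p\<close> must be dominated
    by another neighbour.\<close>
  obtain l where l: "{vx p, vx l} \<in> E" "l \<noteq> j" using p(4) by (rule edge_xx_other)
  have l': "l \<in> {1..2 * n}" "l \<noteq> p" using edge_xx_range[OF l(1)] by auto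
  let ?S' = "insert (vz i) (insert (vx l) (vy ` ({1..2 * n} - {j, p, l})))"
  have zi: "{vy u, vz i} \<in> E \<longleftrightarrow> u = j \<or> u = p" "{vz i, vy u} \<in> E \<longleftrightarrow> u = j \<or> u = p" for u
    using p(1,2) by (auto simp: edge_simps doubleton_eq_iff)
  have "maximal_independent_set (induced E (U {1..n} - {vx j})) Y"
  proof -
    have "\<exists>u\<in>Y. {u, v} \<in> E" if v: "v \<in> U {1..n} - {vx j} - Y" for v
    proof (cases v)
      case (vx t)
      then have "vy t \<in> Y" "{vy t, v} \<in> E" using v by (auto simp: U_def edge_simps)
      then show ?thesis by blast
    next
      case (vz a)
      then have "vy (2 * a) \<in> Y" "{vy (2 * a), v} \<in> E" using v by (auto simp: U_def edge_simps)
      then show ?thesis by blast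
    qed (use v in \<open>auto simp: U_def\<close>)
    moreover have "\<forall>u\<in>Y. \<forall>v\<in>Y. {u, v} \<notin> E" by (auto simp: Y_verts_def edge_simps)
    moreover have "Y \<subseteq> U {1..n} - {vx j}" by (auto simp: U_def)
    ultimately show ?thesis using loopless by (subst maximal_independent_set_induced) auto
  qed
  moreover have "maximal_independent_set (induced E (U {1..n} - {vx j})) ?S'"
  proof -
    have "\<exists>u\<in>?S'. {u, v} \<in> E" if v: "v \<in> U {1..n} - {vx j} - ?S'" for v
    proof (cases v)
      case (vx t)
      then have t: "t \<in> {1..2 * n}" "t \<noteq> j" "t \<noteq> l" using v by (auto simp: U_def)
      show ?thesis
      proof (cases "t = p")
        case True
        then show ?thesis using vx l by (auto simp: insert_commute)
      next
        case False
        then have "vy t \<in> ?S'" "{vy t, v} \<in> E" using vx t by (auto simp: edge_simps)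
        then show ?thesis by blast
      qed
    next
      case (vy t)
      then have "t \<in> {j, p, l}" using v by (auto simp: U_def)
      then show ?thesis using vy zi l' by (auto simp: edge_xy)
    next
      case (vz t)
      then show ?thesis using v p(1) by (auto simp: U_def X_verts_def Y_verts_def edge_zz)
    qed
    moreover have "\<forall>u\<in>?S'. \<forall>v\<in>?S'. {u, v} \<notin> E"
      using loopless zi by (auto simp: edge_xy edge_yx edge_yy edge_xz edge_zx)
    moreover have "?S' \<subseteq> U {1..n} - {vx j}"
      using p(1) l l' by (auto simp: U_def)
    ultimately show ?thesis using loopless by (subst maximal_independent_set_induced) auto
  qed
  ultimately have "card Y = card ?S'" using wc unfolding well_covered_def by blast
  moreover have "card Y = 2 * n" by (simp add: Y_verts_def card_image inj_on_def)
  moreover have "card ?S' = Suc (Suc (card ({1..2 * n} - {j, p, l})))"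
  proof -
    have "card (vy ` ({1..2 * n} - {j, p, l})) = card ({1..2 * n} - {j, p, l})"
      by (simp add: card_image inj_on_def)
    moreover have "vx l \<notin> vy ` ({1..2 * n} - {j, p, l})" "vz i \<notin> vy ` ({1..2 * n} - {j, p, l})"
      by auto
    ultimately show ?thesis by (simp del: card_Diff_insert)
  qed
  moreover have "card ({1..2 * n} - {j, p, l}) + card {j, p, l} = card {1..2 * n}"
  proof -
    have "{j, p, l} \<subseteq> {1..2 * n}" using j p(4) l'(1) by simp
    then show ?thesis
      using card_Diff_subset[of "{j, p, l}" "{1..2 * n}"] card_mono[of "{1..2 * n}" "{j, p, l}"]
      by simp
  qed
  moreover have "card {j, p, l} = 3" using p(3) l(2) l'(2) by auto
  ultimately show False by simp
qed

text \<open>Vertices outside \<open>Z\<close> are excluded by their deletion alone, since a vertex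
  decomposable graph is well-covered.\<close>

lemma Shed_D_graph: "Shed (D_graph n m k) = Z_verts n"
proof (intro equalityI subsetI)
  fix v assume "v \<in> Shed (D_graph n m k)"
  then have "v \<in> Shed (induced E (U {1..n}))" by (simp only: D_graph_induced)
  then have v: "v \<in> U {1..n}" "well_covered (induced E (U {1..n} - {v}))"
    by (auto simp: Shed_def intro: vertex_decomposable_well_covered)
  show "v \<in> Z_verts n"
  proof (cases v)
    case (vx j)
    then show ?thesis using v not_well_covered_delete_x[of j] by (auto simp: U_def)
  next
    case (vy j)
    then show ?thesis using v not_well_covered_delete_y[of j] by (auto simp: U_def)
  next
    case (vz j)
    then show ?thesis using v(1) by (auto simp: U_def Z_verts_def)
  qed
next
  fix v assume "v \<in> Z_verts n"
  then obtain i where i: "v = vz i" "i \<in> {1..n}" by (auto simp: Z_verts_def)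
  have "U {1..n} - {vz i} = U ({1..n} - {i})" by (auto simp: U_def)
  then have "vertex_decomposable (induced E (U {1..n} - {v}))"
    using i(1) vertex_decomposable_U[of "{1..n} - {i}"] by (simp only: Diff_subset)
  moreover have "vertex_decomposable (induced E (U {1..n} - closed_nbhd (induced E (U {1..n})) v))"
    using i vertex_decomposable_link_z[of i] link_z[of "{1..n}" i] by (simp only: subset_refl)
  moreover have "v \<in> U {1..n}" using i by (simp add: U_def)
  ultimately have "v \<in> Shed (induced E (U {1..n}))" by (simp add: Shed_def)
  then show "v \<in> Shed (D_graph n m k)" by (simp only: D_graph_induced)
qed

end

theorem theorem6p3:
  fixes n m :: nat and k :: "nat \<Rightarrow> nat"
  assumes "m \<ge> 1"
    and "\<forall>i\<in>{1..m}. k i \<ge> 2"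
    and "(\<Sum>i=1..m. k i) = n"
  shows "vertex_decomposable (D_graph n m k) \<and> Shed (D_graph n m k) = Z_verts n"
proof -
  interpret D_parameters n m k using assms by unfold_locales
  show ?thesis
    using vertex_decomposable_U[of "{1..n}"] Shed_D_graph
    by (simp only: D_graph_induced subset_refl simp_thms)
qed

end
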